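(* Let $D\ge2$ and $K\ge1$ be integers and let $\vec p$ be a single-edge strategy for labels in $\{1,\dots,K\}$. The following are equivalent: (i) $\sigma_{\vec p}$ is an extreme point of the convex set $\{\sigma_{\vec q}:\vec q\text{ a single-edge strategy}\}$. (ii) Any consistent single-edge strategy achieving $\sigma_{\vec p}$ (i.e. any consistent $\vec q$ with $\sigma_{\vec q}=\sigma_{\vec p}$) must be deterministic. (iii) $\sigma_{\vec p}$ is given by the single-edge strategy "choose whichever label is maximal with respect to the ordering $\alpha(1)<\cdots<\alpha(K)$" of $\{1,\dots,K\}$, for some permutation $\alpha\in S_K$. (iv) $\sigma_{\vec p}$ has a probability mass function whose value distribution is $$\Big\{\frac1{K^D},\frac{2^D-1}{K^D},\frac{3^D-2^D}{K^D},\dots,\frac{K^D-(K-1)^D}{K^D}\Big\},$$ i.e. these are, up to order, the $K$ values $\sigma_{\vec p}(\{1\}),\dots,\sigma_{\vec p}(\{K\})$.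
   Context: Discrete setting: $U^1,\dots,U^D$ are i.i.d. uniform on $\{1,\dots,K\}$. A single-edge strategy is a vector $\vec p=(p_1,\dots,p_D)$ of functions $p_k:\{1,\dots,K\}^D\to[0,1]$ with $\sum_kp_k\equiv1$; given $(U^1,\dots,U^D)=\vec u$, index $J=k$ is chosen with probability $p_k(\vec u)$, and $\sigma_{\vec p}$ is the law of $U^J$, i.e. $\sigma_{\vec p}(\{x\})=K^{-D}\sum_{\vec u}\sum_{j:u_j=x}p_j(\vec u)$. $\vec p$ is consistent if $p_i(\vec u)=p_i(u_{\iota(1)},\dots,u_{\iota(D)})$ for all $i$, all $\vec u$ and all $\iota\in S_D$ with $\iota(i)=i$, and $p_k(\vec u)=p_1(u_k,u_{k+1},\dots,u_D,u_1,\dots,u_{k-1})$ for all $k,\vec u$. $\vec p$ is deterministic if the conditional law of the index $J$ given the observed labels $(U^1,\dots,U^D)$ is almost surely a delta mass, i.e. all $p_k$ are $\{0,1\}$-valued.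
   Formalization: "Deterministic" in (ii) means the chosen label, not the index J, is determined by the label vector: with D≥2 a consistent strategy has p_k=1/D on constant vectors, so none is {0,1}-valued and the literal (ii) always fails (e.g. K=1, where (i), (iii), (iv) hold). *)

theory Defs
  imports "HOL-Analysis.Analysis" "HOL-Combinatorics.Combinatorics"
begin

(* The label set {1..K} is a finite type 'k with CARD('k) = K (so K \<ge> 1).  A label vector
   (u_1,...,u_D) is a list of length D, and indices run over {..<D} instead of {1..D}. *)

type_synonym 'k strategy = "nat \<Rightarrow> 'k list \<Rightarrow> real"

definition label_vectors :: "nat \<Rightarrow> 'k list set" where
  "label_vectors D = {u. length u = D}"

definition single_edge_strategy :: "nat \<Rightarrow> 'k strategy \<Rightarrow> bool" where
  "single_edge_strategy D p \<longleftrightarrow>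
     (\<forall>u\<in>label_vectors D. (\<forall>k<D. 0 \<le> p k u \<and> p k u \<le> 1) \<and> (\<Sum>k<D. p k u) = 1)"

(* The conditional probability that the chosen label U^J is x, given (U^1,...,U^D) = u. *)
definition label_prob :: "nat \<Rightarrow> 'k strategy \<Rightarrow> 'k list \<Rightarrow> 'k \<Rightarrow> real" where
  "label_prob D p u x = (\<Sum>j | j < D \<and> u ! j = x. p j u)"

(* The law of U^J, as the vector of its point masses. *)
definition outcome_law :: "nat \<Rightarrow> 'k::finite strategy \<Rightarrow> real ^ 'k" where
  "outcome_law D p =
     (\<chi> x. (1 / real CARD('k) ^ D) * (\<Sum>u\<in>label_vectors D. label_prob D p u x))"

(* permute_list \<iota> u is (u_\<iota>(1),...,u_\<iota>(D)); with indices starting at 0,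
   rotate k u is the cyclic shift of u starting at entry k. *)
definition consistent :: "nat \<Rightarrow> 'k strategy \<Rightarrow> bool" where
  "consistent D p \<longleftrightarrow>
     (\<forall>i<D. \<forall>u\<in>label_vectors D. \<forall>\<iota>. \<iota> permutes {..<D} \<and> \<iota> i = i
        \<longrightarrow> p i u = p i (permute_list \<iota> u)) \<and>
     (\<forall>k<D. \<forall>u\<in>label_vectors D. p k u = p 0 (rotate k u))"

(* Indices carrying the same label are not distinguished: given the labels, the choice is a
   delta mass as soon as the chosen label is determined.  Asking for every p k u to be 0 or 1
   would be unsatisfiable for consistent strategies, which must split ties evenly; see
   consistent_not_zero_one below.  On label vectors without repetitions the two conditions
   agree. *)
definition deterministic :: "nat \<Rightarrow> 'k strategy \<Rightarrow> bool" where
  "deterministic D p \<longleftrightarrow> (\<forall>u\<in>label_vectors D. \<exists>x. label_prob D p u x = 1)"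

(* The ordering of the labels is \<alpha> 1 < ... < \<alpha> K, so the rank of a label is its
   preimage under \<alpha>.  Ties between indices with the same maximal label are split evenly;
   this has no effect on the outcome law. *)
definition max_indices :: "nat \<Rightarrow> (nat \<Rightarrow> 'k::finite) \<Rightarrow> 'k list \<Rightarrow> nat set" where
  "max_indices D \<alpha> u =
     {k. k < D \<and> (\<forall>j<D. inv_into {1..CARD('k)} \<alpha> (u ! j) \<le> inv_into {1..CARD('k)} \<alpha> (u ! k))}"

definition max_strategy :: "nat \<Rightarrow> (nat \<Rightarrow> 'k::finite) \<Rightarrow> 'k strategy" where
  "max_strategy D \<alpha> k u =
     (if k \<in> max_indices D \<alpha> u then 1 / real (card (max_indices D \<alpha> u)) else 0)"

lemma consistent_not_zero_one:
  fixes p :: "'k strategy"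
  assumes "D \<ge> 2" and p: "single_edge_strategy D p" and c: "consistent D p"
  shows "\<exists>u\<in>label_vectors D. \<forall>k<D. p k u \<noteq> 0 \<and> p k u \<noteq> 1"
proof -
  define u :: "'k list" where "u = replicate D undefined"
  have u: "u \<in> label_vectors D"
    by (simp add: u_def label_vectors_def)
  have eq: "p k u = p 0 u" if "k < D" for k :: nat
  proof -
    have "rotate k u = u"
      unfolding u_def by (rule nth_equalityI) (auto simp: nth_rotate)
    moreover have "p k u = p 0 (rotate k u)"
      using c u that unfolding consistent_def by blast
    ultimately show ?thesis
      by simp
  qed
  have "(\<Sum>k<D. p k u) = (\<Sum>k<D. p 0 u)"
    by (rule sum.cong) (auto intro: eq)
  then have "real D * p 0 u = 1"
    using p u by (simp add: single_edge_strategy_def)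
  then have "p 0 u \<noteq> 0 \<and> p 0 u \<noteq> 1"
    using \<open>D \<ge> 2\<close> by auto
  then have "\<forall>k<D. p k u \<noteq> 0 \<and> p k u \<noteq> 1"
    by (metis eq)
  then show ?thesis
    using u by blast
qed

lemma single_edge_strategy_max_strategy:
  assumes "D \<ge> 1"
  shows "single_edge_strategy D (max_strategy D \<alpha>)"
  unfolding single_edge_strategy_def
proof (intro ballI conjI)
  fix u :: "'a list"
  let ?M = "max_indices D \<alpha> u" and ?r = "\<lambda>j. inv_into {1..CARD('a)} \<alpha> (u ! j)"
  have fin: "finite ?M"
    by (rule finite_subset[of _ "{..<D}"]) (auto simp: max_indices_def)
  have "Max (?r ` {..<D}) \<in> ?r ` {..<D}"
    using assms by (intro Max_in) (auto simp: lessThan_empty_iff)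
  then obtain k where k: "k < D" "?r k = Max (?r ` {..<D})"
    by auto
  have "k \<in> ?M"
    unfolding max_indices_def mem_Collect_eq k(2) using k(1) by (auto intro!: Max_ge)
  then have pos: "card ?M > 0"
    using fin by (auto simp: card_gt_0_iff)
  then have "real (card ?M) \<ge> 1"
    by simp
  then show "\<forall>k<D. 0 \<le> max_strategy D \<alpha> k u \<and> max_strategy D \<alpha> k u \<le> 1"
    by (simp add: max_strategy_def)
  have "(\<Sum>k<D. max_strategy D \<alpha> k u) = (\<Sum>k\<in>?M. 1 / real (card ?M))"
    unfolding max_strategy_def
    by (rule sum.mono_neutral_cong_right) (auto simp: max_indices_def)
  then show "(\<Sum>k<D. max_strategy D \<alpha> k u) = 1"
    using pos by simp
qed

end

theory Submission
  imports Defs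
begin

text \<open>
  The law of a strategy depends only on its kernel \<open>L u x\<close>, the probability of choosing label \<open>x\<close>
  given \<open>u\<close>, and every kernel with \<open>L u\<close> supported on \<open>set u\<close> comes from a strategy.  Averaging a
  kernel over the rearrangements of \<open>u\<close> makes its strategy consistent without changing the law, and
  the average is 0/1-valued only if the kernel is; so (ii) says that every kernel with the given law
  is 0/1-valued.  Then the law is extreme, since a proper mixture of kernels with different laws is
  not 0/1-valued.  Conversely an extreme law comes from a choice function \<open>f\<close> that is unique with its
  law, hence admits no preference cycles, so \<open>f u\<close> is the maximum of \<open>set u\<close> in a linear order.
  Finally, the law \<open>\<sigma>\<close> of a maximum strategy attains equality in the bounds
  \<open>\<sigma> A \<ge> (card A / K) ^ D\<close> for all initial segments \<open>A\<close> of the order, which forces any kernel with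
  that law to choose the maximum.
\<close>

subsection \<open>Label kernels\<close>

definition label_kernel :: "nat \<Rightarrow> ('k::finite list \<Rightarrow> 'k \<Rightarrow> real) \<Rightarrow> bool" where
  "label_kernel D L \<longleftrightarrow>
     (\<forall>u\<in>label_vectors D. (\<forall>x. 0 \<le> L u x) \<and> (\<forall>x. x \<notin> set u \<longrightarrow> L u x = 0) \<and> (\<Sum>x\<in>UNIV. L u x) = 1)"

text \<open>Arbitrary real-valued \<open>L\<close> is allowed, so that the law is linear in
  \<open>L\<close> and also applies to signed perturbations of kernels.\<close>

definition kernel_law :: "nat \<Rightarrow> ('k::finite list \<Rightarrow> 'k \<Rightarrow> real) \<Rightarrow> real ^ 'k" where
  "kernel_law D L = (\<chi> x. (1 / real CARD('k) ^ D) * (\<Sum>u\<in>label_vectors D. L u x))"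

lemma outcome_law_eq_kernel_law: "outcome_law D p = kernel_law D (label_prob D p)"
  by (simp add: outcome_law_def kernel_law_def)

lemma finite_label_vectors [simp]: "finite (label_vectors D :: 'k::finite list set)"
  using finite_lists_length_eq[of "UNIV :: 'k set" D] by (simp add: label_vectors_def)

lemma kernel_law_nth:
  "kernel_law D L $ x = (\<Sum>u\<in>label_vectors D. L u x) / real CARD('k) ^ D"
  for L :: "'k::finite list \<Rightarrow> 'k \<Rightarrow> real"
  by (simp add: kernel_law_def)

lemma kernel_law_cong:
  assumes "\<And>u x. u \<in> label_vectors D \<Longrightarrow> L u x = L' u x"
  shows "kernel_law D L = kernel_law D L'"
  using assms by (simp add: vec_eq_iff kernel_law_nth)

lemma label_kernelD:
  assumes "label_kernel D L" "u \<in> label_vectors D"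
  shows "0 \<le> L u x" "x \<notin> set u \<Longrightarrow> L u x = 0" "(\<Sum>x\<in>UNIV. L u x) = 1"
  using assms by (auto simp: label_kernel_def)

lemma label_kernel_le_1:
  assumes "label_kernel D L" "u \<in> label_vectors D"
  shows "L u x \<le> 1"
  using member_le_sum[of x UNIV "L u"] label_kernelD[OF assms] by simp

lemma label_kernel_eq_of_bool:
  assumes "label_kernel D L" "u \<in> label_vectors D" "L u x = 1"
  shows "L u y = of_bool (y = x)"
proof (cases "y = x")
  case False
  have "L u x + L u y = sum (L u) {x, y}"
    using False by simp
  also have "\<dots> \<le> sum (L u) UNIV"
    by (rule sum_mono2) (auto simp: label_kernelD(1)[OF assms(1,2)])
  finally show ?thesis
    using label_kernelD(1,3)[OF assms(1,2)] assms(3) False by (simp add: order_antisym)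
qed (use assms in simp)

lemma label_kernel_label_prob:
  fixes p :: "'k::finite strategy"
  assumes "single_edge_strategy D p"
  shows "label_kernel D (label_prob D p)"
  unfolding label_kernel_def
proof (intro ballI conjI allI impI)
  fix u :: "'k list" assume u: "u \<in> label_vectors D"
  then have p: "\<And>j. j < D \<Longrightarrow> 0 \<le> p j u" "(\<Sum>j<D. p j u) = 1"
    using assms by (auto simp: single_edge_strategy_def)
  show "0 \<le> label_prob D p u x" for x
    unfolding label_prob_def using p by (intro sum_nonneg) auto
  show "label_prob D p u x = 0" if "x \<notin> set u" for x
    using that u unfolding label_prob_def label_vectors_def by (intro sum.neutral) auto
  have "(\<Sum>x\<in>UNIV. label_prob D p u x) = (\<Sum>x\<in>UNIV. \<Sum>j\<in>{j \<in> {..<D}. u ! j = x}. p j u)"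
    by (simp add: label_prob_def)
  also have "\<dots> = (\<Sum>j<D. p j u)"
    by (rule sum.group) auto
  finally show "(\<Sum>x\<in>UNIV. label_prob D p u x) = 1"
    using p by simp
qed

text \<open>The mass of a label is split evenly among its occurrences. An index is thus treated only
  according to the label it carries, as consistency demands.\<close>

definition kernel_strategy :: "('k list \<Rightarrow> 'k \<Rightarrow> real) \<Rightarrow> 'k strategy" where
  "kernel_strategy L k u = L u (u ! k) / real (count_list u (u ! k))"

lemma label_prob_kernel_strategy:
  assumes L: "label_kernel D L" and u: "u \<in> label_vectors D"
  shows "label_prob D (kernel_strategy L) u x = L u x"
proof (cases "x \<in> set u")
  case False
  then have "{j. j < D \<and> u ! j = x} = {}"
    using u by (auto simp: label_vectors_def)
  then show ?thesis
    unfolding label_prob_def by (metis label_kernelD(2)[OF L u False] sum.empty)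
next
  case True
  have c: "count_list u x = card {j. j < D \<and> u ! j = x}"
    using u by (auto simp: count_list_eq_length_filter length_filter_conv_card label_vectors_def eq_commute)
  moreover have "count_list u x \<noteq> 0"
    using True by (simp add: count_list_0_iff)
  moreover have "label_prob D (kernel_strategy L) u x = (\<Sum>j | j < D \<and> u ! j = x. L u x / real (count_list u x))"
    unfolding label_prob_def kernel_strategy_def by (rule sum.cong) auto
  ultimately show ?thesis
    by simp
qed

lemma single_edge_strategy_kernel_strategy:
  assumes L: "label_kernel D L"
  shows "single_edge_strategy D (kernel_strategy L)"
  unfolding single_edge_strategy_def
proof (intro ballI conjI)
  fix u :: "'a list" assume u: "u \<in> label_vectors D"
  let ?p = "kernel_strategy L"
  have nonneg: "0 \<le> ?p k u" for k
    using label_kernelD(1)[OF L u] by (simp add: kernel_strategy_def)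
  have "(\<Sum>k<D. ?p k u) = (\<Sum>x\<in>UNIV. \<Sum>j\<in>{j \<in> {..<D}. u ! j = x}. ?p j u)"
    by (rule sum.group[symmetric]) auto
  also have "\<dots> = (\<Sum>x\<in>UNIV. L u x)"
    using label_prob_kernel_strategy[OF L u] by (simp add: label_prob_def)
  finally show sum: "(\<Sum>k<D. ?p k u) = 1"
    using label_kernelD(3)[OF L u] by simp
  show "\<forall>k<D. 0 \<le> ?p k u \<and> ?p k u \<le> 1"
    using nonneg member_le_sum[of _ "{..<D}" "\<lambda>k. ?p k u"] sum by fastforce
qed

lemma outcome_law_kernel_strategy:
  assumes "label_kernel D L"
  shows "outcome_law D (kernel_strategy L) = kernel_law D L"
  unfolding outcome_law_eq_kernel_law
  by (rule kernel_law_cong) (rule label_prob_kernel_strategy[OF assms])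

text \<open>\<open>label_prob\<close> turns strategies into kernels, \<open>kernel_strategy\<close>
  turns kernels into strategies, and both preserve the law. Extremality can therefore be studied
  among kernels.\<close>

lemma outcome_laws_eq_kernel_laws:
  "{outcome_law D q | q. single_edge_strategy D q} = {kernel_law D L | L. label_kernel D L}"
  using label_kernel_label_prob single_edge_strategy_kernel_strategy
    outcome_law_kernel_strategy outcome_law_eq_kernel_law
  by (smt (verit) Collect_cong)

subsection \<open>Symmetrization\<close>

text \<open>The average runs over the distinct rearrangements of \<open>u\<close>. Each of them
  arises from equally many index permutations, so this is the average over the symmetric
  group.\<close>

definition symmetrize :: "nat \<Rightarrow> ('k list \<Rightarrow> 'k \<Rightarrow> real) \<Rightarrow> 'k list \<Rightarrow> 'k \<Rightarrow> real" where
  "symmetrize D L u x =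
     (\<Sum>v | v \<in> label_vectors D \<and> mset v = mset u. L v x) / real (card {v \<in> label_vectors D. mset v = mset u})"

text \<open>A label vector lies in its own rearrangement class, so the average over the class does
  not divide by 0.\<close>

lemma card_mset_class_pos:
  fixes u :: "'k::finite list"
  assumes "u \<in> label_vectors D"
  shows "real (card {v \<in> label_vectors D. mset v = mset u}) > 0"
  using assms by (auto simp: card_gt_0_iff)

lemma label_kernel_symmetrize:
  fixes L :: "'k::finite list \<Rightarrow> 'k \<Rightarrow> real"
  assumes L: "label_kernel D L"
  shows "label_kernel D (symmetrize D L)"
  unfolding label_kernel_def
proof (intro ballI conjI allI impI)
  fix u :: "'k list" assume u: "u \<in> label_vectors D"
  let ?C = "{v \<in> label_vectors D. mset v = mset u}"
  show "0 \<le> symmetrize D L u x" for x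
    unfolding symmetrize_def using label_kernelD(1)[OF L] by (intro divide_nonneg_nonneg sum_nonneg) auto
  show "symmetrize D L u x = 0" if x: "x \<notin> set u" for x
  proof -
    have "L v x = 0" if "v \<in> ?C" for v
      using that x label_kernelD(2)[OF L] mset_eq_setD[of v u] by auto
    then show ?thesis
      by (simp add: symmetrize_def)
  qed
  have "(\<Sum>x\<in>UNIV. \<Sum>v\<in>?C. L v x) = (\<Sum>v\<in>?C. \<Sum>x\<in>UNIV. L v x)"
    by (rule sum.swap)
  also have "\<dots> = (\<Sum>v\<in>?C. 1)"
    by (rule sum.cong) (auto simp: label_kernelD(3)[OF L])
  finally have "(\<Sum>x\<in>UNIV. symmetrize D L u x) = real (card ?C) / real (card ?C)"
    by (simp add: symmetrize_def flip: sum_divide_distrib)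
  also have "\<dots> = 1"
    by (rule divide_self) (use card_mset_class_pos[OF u] in linarith)
  finally show "(\<Sum>x\<in>UNIV. symmetrize D L u x) = 1" .
qed

text \<open>Double counting over pairs with equal multisets: each \<open>L v x\<close> is
  distributed in equal shares over the class of \<open>v\<close>, and the shares add up to
  \<open>L v x\<close>.\<close>

lemma kernel_law_symmetrize:
  fixes L :: "'k::finite list \<Rightarrow> 'k \<Rightarrow> real"
  shows "kernel_law D (symmetrize D L) = kernel_law D L"
proof -
  let ?V = "label_vectors D :: 'k list set"
  let ?c = "\<lambda>u. real (card {v \<in> ?V. mset v = mset u})"
  have "(\<Sum>u\<in>?V. symmetrize D L u x) = (\<Sum>u\<in>?V. L u x)" for x
  proof -
    have "(\<Sum>u\<in>?V. symmetrize D L u x) = (\<Sum>u\<in>?V. \<Sum>v\<in>{v\<in>?V. mset v = mset u}. L v x / ?c u)"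
      by (simp add: symmetrize_def sum_divide_distrib)
    also have "\<dots> = (\<Sum>v\<in>?V. \<Sum>u\<in>{u\<in>?V. mset v = mset u}. L v x / ?c u)"
      by (rule sum.swap_restrict) auto
    also have "\<dots> = (\<Sum>v\<in>?V. \<Sum>u\<in>{u\<in>?V. mset u = mset v}. L v x / ?c v)"
      by (intro sum.cong) auto
    also have "\<dots> = (\<Sum>v\<in>?V. L v x)"
      using card_mset_class_pos by (intro sum.cong) auto
    finally show ?thesis .
  qed
  then show ?thesis
    by (simp add: vec_eq_iff kernel_law_nth)
qed

text \<open>The strategy depends on \<open>i\<close> and \<open>u\<close> only through
  \<open>u ! i\<close> and the multiset of \<open>u\<close>. Permutations fixing \<open>i\<close>
  preserve both, and a rotation by \<open>k\<close> moves entry \<open>k\<close> to position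
  0.\<close>

lemma consistent_symmetrize:
  fixes L :: "'k list \<Rightarrow> 'k \<Rightarrow> real"
  shows "consistent D (kernel_strategy (symmetrize D L))"
proof -
  have eq: "kernel_strategy (symmetrize D L) i u = kernel_strategy (symmetrize D L) j v"
    if "mset u = mset v" "u ! i = v ! j" for u v :: "'k list" and i j
    using that by (simp add: kernel_strategy_def symmetrize_def flip: count_mset)
  show ?thesis
    unfolding consistent_def
  proof (intro conjI allI impI ballI; (elim conjE)?)
    fix i and u :: "'k list" and \<iota> assume "i < D" "u \<in> label_vectors D" "\<iota> permutes {..<D}" "\<iota> i = i"
    then show "kernel_strategy (symmetrize D L) i u = kernel_strategy (symmetrize D L) i (permute_list \<iota> u)"
      by (intro eq) (auto simp: label_vectors_def permute_list_nth)
  next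
    fix k and u :: "'k list" assume "k < D" "u \<in> label_vectors D"
    moreover have "mset (rotate k u) = mset u"
      by (metis append_take_drop_id mset_append rotate_drop_take union_commute)
    ultimately show "kernel_strategy (symmetrize D L) k u = kernel_strategy (symmetrize D L) 0 (rotate k u)"
      by (intro eq) (auto simp: label_vectors_def nth_rotate)
  qed
qed

text \<open>An average of numbers that are at most 1 equals 1 only if all of them do.\<close>

lemma symmetrize_eq_1D:
  fixes L :: "'k::finite list \<Rightarrow> 'k \<Rightarrow> real"
  assumes L: "label_kernel D L" and u: "u \<in> label_vectors D" and 1: "symmetrize D L u x = 1"
  shows "L u x = 1"
proof -
  let ?C = "{v \<in> label_vectors D. mset v = mset u}"
  have "(\<Sum>v\<in>?C. 1 - L v x) = 0"
    using 1 card_mset_class_pos[OF u] by (simp add: symmetrize_def sum_subtractf field_simps)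
  moreover have "\<forall>v\<in>?C. 0 \<le> 1 - L v x"
    using label_kernel_le_1[OF L] by simp
  ultimately have "\<forall>v\<in>?C. 1 - L v x = 0"
    by (subst (asm) sum_nonneg_eq_0_iff) auto
  with u show ?thesis
    by simp
qed

section \<open>Condition (ii) in terms of kernels\<close>

definition zero_one_kernels :: "nat \<Rightarrow> real ^ 'k::finite \<Rightarrow> bool" where
  "zero_one_kernels D \<sigma> \<longleftrightarrow>
     (\<forall>L. label_kernel D L \<and> kernel_law D L = \<sigma> \<longrightarrow> (\<forall>u\<in>label_vectors D. \<exists>x. L u x = 1))"

lemma zero_one_kernels_iff_deterministic:
  fixes \<sigma> :: "real ^ 'k::finite"
  shows "zero_one_kernels D \<sigma> \<longleftrightarrow>
     (\<forall>q. single_edge_strategy D q \<and> consistent D q \<and> outcome_law D q = \<sigma> \<longrightarrow> deterministic D q)"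
  (is "?l \<longleftrightarrow> ?r")
proof
  assume ?l
  then show ?r
    unfolding zero_one_kernels_def deterministic_def outcome_law_eq_kernel_law
    using label_kernel_label_prob by blast
next
  assume r: ?r
  show ?l
    unfolding zero_one_kernels_def
  proof (intro allI impI ballI; elim conjE)
    fix L and u :: "'k list" assume L: "label_kernel D L" "kernel_law D L = \<sigma>" and u: "u \<in> label_vectors D"
    let ?M = "symmetrize D L"
    have M: "label_kernel D ?M"
      by (rule label_kernel_symmetrize) fact
    have "deterministic D (kernel_strategy ?M)"
      using r M L single_edge_strategy_kernel_strategy consistent_symmetrize
      by (metis outcome_law_kernel_strategy kernel_law_symmetrize)
    with u label_prob_kernel_strategy[OF M u] obtain x where "?M u x = 1"
      by (auto simp: deterministic_def)
    with symmetrize_eq_1D[OF L(1) u] show "\<exists>x. L u x = 1"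
      by blast
  qed
qed

text \<open>If the law were a proper mixture of two laws, the same mixture of their kernels would
  have that law. Being 0/1-valued, it forces the two kernels, and so the two laws, to agree.\<close>

lemma zero_one_kernels_imp_extreme:
  fixes L :: "'k::finite list \<Rightarrow> 'k \<Rightarrow> real"
  assumes L: "label_kernel D L" and zo: "zero_one_kernels D (kernel_law D L)"
  shows "kernel_law D L extreme_point_of {kernel_law D L | L. label_kernel D L}"
  unfolding extreme_point_of_def
proof (intro conjI ballI notI)
  show "kernel_law D L \<in> {kernel_law D L | L. label_kernel D L}"
    using L by blast
next
  fix a b assume "a \<in> {kernel_law D L | L. label_kernel D L}" "b \<in> {kernel_law D L | L. label_kernel D L}"
    and seg: "kernel_law D L \<in> open_segment a b"
  then obtain A B where A: "label_kernel D A" "a = kernel_law D A" and B: "label_kernel D B" "b = kernel_law D B"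
    by blast
  from seg obtain t where t: "0 < t" "t < 1" and ab: "a \<noteq> b" and eq: "kernel_law D L = (1 - t) *\<^sub>R a + t *\<^sub>R b"
    by (auto simp: in_segment)
  define M where "M = (\<lambda>u x. (1 - t) * A u x + t * B u x)"
  have M: "label_kernel D M"
    using A(1) B(1) t unfolding label_kernel_def M_def
    by (auto simp: sum.distrib simp flip: sum_distrib_left)
  have "kernel_law D M = kernel_law D L"
    unfolding eq A B M_def
    by (simp add: vec_eq_iff kernel_law_nth sum.distrib add_divide_distrib flip: sum_distrib_left)
  with zo M have 1: "\<exists>x. M u x = 1" if "u \<in> label_vectors D" for u
    using that by (auto simp: zero_one_kernels_def)
  have "A u y = B u y" if u: "u \<in> label_vectors D" for u y
  proof -
    obtain x where "M u x = 1"
      using 1[OF u] by blast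
    \<comment> \<open>Both summands are nonnegative and both weights are positive, so
      \<open>A u x\<close> and \<open>B u x\<close> are 1.\<close>
    then have "(1 - t) * (1 - A u x) + t * (1 - B u x) = 0"
      by (simp add: M_def algebra_simps)
    then have "A u x = 1" "B u x = 1"
      using t label_kernel_le_1[OF A(1) u, of x] label_kernel_le_1[OF B(1) u, of x]
      by (simp_all add: add_nonneg_eq_0_iff)
    then show ?thesis
      using label_kernel_eq_of_bool A(1) B(1) u by metis
  qed
  with ab A B show False
    by (metis kernel_law_cong)
qed

subsection \<open>Extreme laws\<close>

text \<open>\<open>x\<close> is the midpoint of \<open>x + d\<close> and \<open>x - d\<close>. This
  is how extremality is used below: no nonzero displacement is possible in both directions.\<close>

lemma extreme_point_of_symmetric:
  assumes "x extreme_point_of S" "x + d \<in> S" "x - d \<in> S"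
  shows "d = 0"
proof (rule ccontr)
  assume "d \<noteq> 0"
  moreover have "(x + d) - (x - d) = 2 *\<^sub>R d"
    by (simp add: scaleR_2)
  ultimately have "x + d \<noteq> x - d"
    by (metis diff_self scaleR_eq_0_iff zero_neq_numeral)
  moreover have "midpoint (x + d) (x - d) = x"
    by (simp add: midpoint_def flip: scaleR_2)
  ultimately show False
    using assms midpoint_in_open_segment[of "x + d" "x - d"] by (auto simp: extreme_point_of_def)
qed

lemma kernel_law_add:
  "kernel_law D (\<lambda>u x. L u x + M u x) = kernel_law D L + kernel_law D M"
  by (simp add: vec_eq_iff kernel_law_nth sum.distrib add_divide_distrib)

lemma kernel_law_diff:
  "kernel_law D (\<lambda>u x. L u x - M u x) = kernel_law D L - kernel_law D M"
  by (simp add: vec_eq_iff kernel_law_nth sum_subtractf diff_divide_distrib)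

lemma kernel_law_single:
  fixes d :: "'k::finite \<Rightarrow> real"
  assumes "u \<in> label_vectors D"
  shows "kernel_law D (\<lambda>v x. if v = u then d x else 0) = (1 / real CARD('k) ^ D) *\<^sub>R (\<chi> x. d x)"
  using assms by (simp add: vec_eq_iff kernel_law_nth)

text \<open>If \<open>L u\<close> charged two labels, some mass could be moved from either one to
  the other at \<open>u\<close> alone, displacing the law in opposite directions.\<close>

lemma extreme_imp_zero_one:
  fixes L :: "'k::finite list \<Rightarrow> 'k \<Rightarrow> real"
  assumes L: "label_kernel D L"
    and ext: "kernel_law D L extreme_point_of {kernel_law D L | L. label_kernel D L}"
    and u: "u \<in> label_vectors D"
  shows "\<exists>x. L u x = 1"
proof -
  note Lu = label_kernelD[OF L u]
  obtain x where x: "L u x \<noteq> 0"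
    using Lu(3) by (metis sum.neutral zero_neq_one)
  have "L u x = 1"
  proof (rule ccontr)
    assume "L u x \<noteq> 1"
    moreover have "(\<Sum>z\<in>UNIV. L u z) = L u x + (\<Sum>z\<in>UNIV - {x}. L u z)"
      by (rule sum.remove) auto
    ultimately have "(\<Sum>z\<in>UNIV - {x}. L u z) \<noteq> 0"
      using Lu(3) by simp
    then obtain y where y: "y \<noteq> x" "L u y \<noteq> 0"
      by (metis DiffE insertI1 sum.neutral)
    \<comment> \<open>The largest amount that can be taken from either label without making its
      probability negative.\<close>
    define e where "e = min (L u x) (L u y)"
    have e: "e > 0" "e \<le> L u x" "e \<le> L u y"
      using x y Lu(1)[of x] Lu(1)[of y] by (auto simp: e_def)
    have xy: "x \<in> set u" "y \<in> set u"
      using x y Lu(2) by blast+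
    define d where "d z = (if z = x then e else if z = y then - e else 0)" for z
    have d_sum: "(\<Sum>z\<in>UNIV. d z) = 0"
    proof -
      have "(\<Sum>z\<in>UNIV. d z) = (\<Sum>z\<in>{x, y}. d z)"
        by (rule sum.mono_neutral_right) (auto simp: d_def)
      then show ?thesis
        using y by (simp add: d_def)
    qed
    define M where "M v z = (if v = u then d z else 0)" for v z
    have "(\<Sum>z\<in>UNIV. M v z) = 0" for v
      by (cases "v = u") (simp_all add: M_def d_sum)
    moreover have "M v z = 0" if "z \<notin> set v" for v z
      using that xy by (auto simp: M_def d_def)
    moreover have "0 \<le> L v z + M v z" "0 \<le> L v z - M v z" if "v \<in> label_vectors D" for v z
      using e label_kernelD(1)[OF L that] by (auto simp: M_def d_def)
    ultimately have "label_kernel D (\<lambda>v z. L v z + M v z)" "label_kernel D (\<lambda>v z. L v z - M v z)"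
      using L by (auto simp: label_kernel_def sum.distrib sum_subtractf)
    then have "kernel_law D L + kernel_law D M \<in> {kernel_law D L | L. label_kernel D L}"
      "kernel_law D L - kernel_law D M \<in> {kernel_law D L | L. label_kernel D L}"
      by (auto simp flip: kernel_law_add kernel_law_diff)
    from extreme_point_of_symmetric[OF ext this] have "kernel_law D M $ x = 0"
      by simp
    then have "d x = 0"
      using kernel_law_single[OF u, of d] unfolding M_def by simp
    then show False
      using e by (simp add: d_def)
  qed
  then show ?thesis ..
qed

section \<open>Choice functions with extreme laws\<close>

definition choice_law :: "nat \<Rightarrow> ('k::finite list \<Rightarrow> 'k) \<Rightarrow> real ^ 'k" where
  "choice_law D f = kernel_law D (\<lambda>u x. of_bool (x = f u))"

lemma label_kernel_choice:
  assumes "\<And>u. u \<in> label_vectors D \<Longrightarrow> f u \<in> set u"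
  shows "label_kernel D (\<lambda>u x. of_bool (x = f u))"
  using assms by (auto simp: label_kernel_def of_bool_def)

text \<open>Every label vector has weight \<open>1 / K ^ D\<close>, so the displacement depends only
  on the old and the new value. This makes exchanges of values between vectors neutral.\<close>

lemma choice_law_upd:
  fixes f :: "'k::finite list \<Rightarrow> 'k"
  assumes "u \<in> label_vectors D"
  shows "choice_law D (f(u := a)) =
    choice_law D f + (1 / real CARD('k) ^ D) *\<^sub>R (axis a 1 - axis (f u) 1)"
proof -
  let ?d = "\<lambda>x. of_bool (x = a) - of_bool (x = f u) :: real"
  have "choice_law D (f(u := a)) =
      kernel_law D (\<lambda>v x. of_bool (x = f v) + (if v = u then ?d x else 0))"
    unfolding choice_law_def by (rule kernel_law_cong) auto
  also have "\<dots> = choice_law D f + (1 / real CARD('k) ^ D) *\<^sub>R (\<chi> x. ?d x)"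
    unfolding kernel_law_add choice_law_def using kernel_law_single[OF assms, of ?d] by simp
  also have "(\<chi> x. ?d x) = axis a 1 - axis (f u) 1"
    by (simp add: vec_eq_iff axis_def)
  finally show ?thesis .
qed

text \<open>If two choice functions had the same law, exchanging their values at a single label vector
  would move that law in two opposite directions.\<close>

lemma extreme_choice_unique:
  fixes f g :: "'k::finite list \<Rightarrow> 'k"
  assumes ext: "choice_law D f extreme_point_of {kernel_law D L | L. label_kernel D L}"
    and f: "\<And>u. u \<in> label_vectors D \<Longrightarrow> f u \<in> set u"
    and g: "\<And>u. u \<in> label_vectors D \<Longrightarrow> g u \<in> set u"
    and eq: "choice_law D g = choice_law D f" and u: "u \<in> label_vectors D"
  shows "g u = f u"
proof -
  define d :: "real ^ 'k" where "d = (1 / real CARD('k) ^ D) *\<^sub>R (axis (g u) 1 - axis (f u) 1)"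
  have law: "choice_law D h \<in> {kernel_law D L | L. label_kernel D L}"
    if "\<And>u. u \<in> label_vectors D \<Longrightarrow> h u \<in> set u" for h :: "'k list \<Rightarrow> 'k"
    using label_kernel_choice[OF that] by (auto simp: choice_law_def)
  have "choice_law D f + d = choice_law D (f(u := g u))"
    by (simp add: choice_law_upd u d_def)
  moreover have "choice_law D f - d = choice_law D (g(u := f u))"
    by (simp add: choice_law_upd u d_def eq algebra_simps)
  moreover have "choice_law D (f(u := g u)) \<in> {kernel_law D L | L. label_kernel D L}"
    "choice_law D (g(u := f u)) \<in> {kernel_law D L | L. label_kernel D L}"
    by (rule law; use f g u in auto)+
  ultimately have "d = 0"
    by (intro extreme_point_of_symmetric[OF ext]) simp_all
  then have "d $ g u = 0"
    by simp
  then show ?thesis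
    by (simp add: d_def axis_def split: if_splits)
qed

text \<open>A preference cycle could be turned: shifting the choice along the cycle preserves the law.\<close>

lemma extreme_choice_acyclic:
  fixes f :: "'k::finite list \<Rightarrow> 'k"
  assumes ext: "choice_law D f extreme_point_of {kernel_law D L | L. label_kernel D L}"
    and f: "\<And>u. u \<in> label_vectors D \<Longrightarrow> f u \<in> set u"
  shows "\<lbrakk>u \<in> label_vectors D; v \<in> label_vectors D; f u \<in> set v; f v \<in> set u\<rbrakk> \<Longrightarrow> f u = f v"
    and "\<lbrakk>u \<in> label_vectors D; v \<in> label_vectors D; w \<in> label_vectors D;
          f v \<in> set u; f w \<in> set v; f u \<in> set w\<rbrakk> \<Longrightarrow> f u = f v \<or> f v = f w \<or> f w = f u"
proof -
  assume uv: "u \<in> label_vectors D" "v \<in> label_vectors D" "f u \<in> set v" "f v \<in> set u"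
  show "f u = f v"
  proof (rule ccontr)
    assume ne: "f u \<noteq> f v"
    \<comment> \<open>Each value moves to a vector that contains it, and the two displacements of
      the law cancel.\<close>
    let ?g = "f(u := f v, v := f u)"
    have "u \<noteq> v"
      using ne by auto
    then have "choice_law D ?g = choice_law D f"
      using uv by (simp add: choice_law_upd algebra_simps)
    moreover have "?g z \<in> set z" if "z \<in> label_vectors D" for z
      using that uv f by auto
    ultimately have "?g v = f v"
      by (intro extreme_choice_unique[OF ext f _ _ uv(2)])
    then show False
      using ne by simp
  qed
next
  assume uvw: "u \<in> label_vectors D" "v \<in> label_vectors D" "w \<in> label_vectors D"
    "f v \<in> set u" "f w \<in> set v" "f u \<in> set w"
  show "f u = f v \<or> f v = f w \<or> f w = f u"
  proof (rule ccontr)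
    assume ne: "\<not> ?thesis"
    \<comment> \<open>The values move one place around the cycle. Cycles of length 2 and 3 suffice
      below, for antisymmetry and transitivity of the preference.\<close>
    let ?g = "f(u := f v, v := f w, w := f u)"
    have "u \<noteq> v" "v \<noteq> w" "w \<noteq> u"
      using ne by auto
    then have "choice_law D ?g = choice_law D f"
      using uvw by (simp add: choice_law_upd algebra_simps)
    moreover have "?g z \<in> set z" if "z \<in> label_vectors D" for z
      using that uvw f by auto
    ultimately have "?g w = f w"
      by (intro extreme_choice_unique[OF ext f _ _ uvw(3)])
    then show False
      using ne by simp
  qed
qed

subsection \<open>Maximum strategies\<close>

lemma rank_UNIV:
  fixes \<alpha> :: "nat \<Rightarrow> 'k::finite"
  assumes \<alpha>: "bij_betw \<alpha> {1..CARD('k)} UNIV"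
  shows "inj (inv_into {1..CARD('k)} \<alpha>)" "inv_into {1..CARD('k)} \<alpha> x \<in> {1..CARD('k)}"
    "\<alpha> (inv_into {1..CARD('k)} \<alpha> x) = x"
  using bij_betw_inv_into[OF \<alpha>] bij_betw_inv_into_right[OF \<alpha>] by (auto simp: bij_betw_def)

text \<open>Ranks are injective, so only indices carrying \<open>a\<close> attain the maximum;
  splitting ties among them does not affect the chosen label.\<close>

lemma label_prob_max_strategy:
  fixes \<alpha> :: "nat \<Rightarrow> 'k::finite"
  assumes \<alpha>: "bij_betw \<alpha> {1..CARD('k)} UNIV" and u: "u \<in> label_vectors D"
    and a: "a \<in> set u"
    and max: "\<And>y. y \<in> set u \<Longrightarrow> inv_into {1..CARD('k)} \<alpha> y \<le> inv_into {1..CARD('k)} \<alpha> a"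
  shows "label_prob D (max_strategy D \<alpha>) u x = of_bool (x = a)"
proof -
  have D: "D > 0"
    using u a by (cases u) (auto simp: label_vectors_def)
  have zero: "max_strategy D \<alpha> k u = 0" if "k < D" "u ! k \<noteq> a" for k
  proof -
    obtain j where "j < D" "u ! j = a"
      using a u by (auto simp: in_set_conv_nth label_vectors_def)
    moreover have "inv_into {1..CARD('k)} \<alpha> (u ! k) < inv_into {1..CARD('k)} \<alpha> a"
      using max[of "u ! k"] that u inj_eq[OF rank_UNIV(1)[OF \<alpha>]]
      by (auto simp: label_vectors_def order_less_le)
    ultimately have "k \<notin> max_indices D \<alpha> u"
      by (auto simp: max_indices_def not_le)
    then show ?thesis
      by (simp add: max_strategy_def)
  qed
  have L: "label_kernel D (label_prob D (max_strategy D \<alpha>))"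
    using D by (intro label_kernel_label_prob single_edge_strategy_max_strategy) simp
  have other: "label_prob D (max_strategy D \<alpha>) u y = 0" if "y \<noteq> a" for y
    unfolding label_prob_def by (rule sum.neutral) (use that zero in auto)
  have "label_prob D (max_strategy D \<alpha>) u a = (\<Sum>y\<in>UNIV. label_prob D (max_strategy D \<alpha>) u y)"
    using sum.mono_neutral_left[of UNIV "{a}" "label_prob D (max_strategy D \<alpha>) u"] other by auto
  then show ?thesis
    using other label_kernelD(3)[OF L u] by simp
qed

lemma maximal_label:
  fixes r :: "'k \<Rightarrow> nat"
  assumes "u \<noteq> []"
  obtains a where "a \<in> set u" "\<And>y. y \<in> set u \<Longrightarrow> r y \<le> r a"
proof -
  have "Max (r ` set u) \<in> r ` set u"
    using assms by (intro Max_in) auto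
  then obtain a where "a \<in> set u" "r a = Max (r ` set u)"
    by auto
  then show ?thesis
    using that[of a] Max_ge[of "r ` set u"] by auto
qed

section \<open>Masses of initial segments\<close>

lemma kernel_law_sum:
  fixes L :: "'k::finite list \<Rightarrow> 'k \<Rightarrow> real"
  shows "(\<Sum>x\<in>A. kernel_law D L $ x) = (\<Sum>u\<in>label_vectors D. \<Sum>x\<in>A. L u x) / real CARD('k) ^ D"
  unfolding kernel_law_nth by (subst sum.swap) (simp add: sum_divide_distrib)

lemma card_label_vectors_subset:
  fixes A :: "'k::finite set"
  shows "card {u \<in> label_vectors D. set u \<subseteq> A} = card A ^ D"
  using card_lists_length_eq[of A D] by (simp add: label_vectors_def conj_commute)

text \<open>The maximum of \<open>u\<close> lies in an initial segment exactly when all labels of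
  \<open>u\<close> do, so the mass counts the vectors over \<open>m\<close> labels.\<close>

lemma downset_mass_max_strategy:
  fixes \<alpha> :: "nat \<Rightarrow> 'k::finite"
  assumes D: "D \<ge> 1" and \<alpha>: "bij_betw \<alpha> {1..CARD('k)} UNIV" and m: "m \<le> CARD('k)"
  shows "(\<Sum>x\<in>\<alpha> ` {1..m}. outcome_law D (max_strategy D \<alpha>) $ x) = real m ^ D / real CARD('k) ^ D"
proof -
  let ?r = "inv_into {1..CARD('k)} \<alpha>" and ?L = "label_prob D (max_strategy D \<alpha>)"
  have mem: "x \<in> \<alpha> ` {1..m} \<longleftrightarrow> ?r x \<le> m" for x
  proof
    assume "x \<in> \<alpha> ` {1..m}"
    then show "?r x \<le> m"
      using m bij_betw_inv_into_left[OF \<alpha>] by auto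
  next
    assume "?r x \<le> m"
    then show "x \<in> \<alpha> ` {1..m}"
      using rank_UNIV(2,3)[OF \<alpha>, of x] by (intro image_eqI[of _ _ "?r x"]) auto
  qed
  have inner: "(\<Sum>x\<in>\<alpha> ` {1..m}. ?L u x) = of_bool (set u \<subseteq> \<alpha> ` {1..m})" if u: "u \<in> label_vectors D" for u
  proof -
    have "u \<noteq> []"
      using u D by (auto simp: label_vectors_def)
    then obtain a where a: "a \<in> set u" "\<And>y. y \<in> set u \<Longrightarrow> ?r y \<le> ?r a"
      using maximal_label by blast
    have "(\<Sum>x\<in>\<alpha> ` {1..m}. ?L u x) = of_bool (a \<in> \<alpha> ` {1..m})"
      by (simp add: label_prob_max_strategy[OF \<alpha> u a] of_bool_def)
    also have "a \<in> \<alpha> ` {1..m} \<longleftrightarrow> set u \<subseteq> \<alpha> ` {1..m}"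
      unfolding subset_eq mem using a by (meson order_trans)
    finally show ?thesis .
  qed
  have "card (\<alpha> ` {1..m}) = m"
    using \<alpha> m by (subst card_image) (auto simp: bij_betw_def intro: inj_on_subset)
  moreover have "(\<Sum>u\<in>label_vectors D. \<Sum>x\<in>\<alpha> ` {1..m}. ?L u x) = card {u \<in> label_vectors D. set u \<subseteq> \<alpha> ` {1..m}}"
  proof -
    have "(\<Sum>u\<in>label_vectors D. \<Sum>x\<in>\<alpha> ` {1..m}. ?L u x) = (\<Sum>u\<in>label_vectors D. of_bool (set u \<subseteq> \<alpha> ` {1..m}))"
      by (rule sum.cong) (rule refl, rule inner)
    then show ?thesis
      by (simp add: of_bool_def sum.If_cases Int_def)
  qed
  ultimately show ?thesis
    unfolding outcome_law_eq_kernel_law kernel_law_sum by (simp add: card_label_vectors_subset)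
qed

lemma outcome_law_max_strategy:
  fixes \<alpha> :: "nat \<Rightarrow> 'k::finite"
  assumes D: "D \<ge> 1" and \<alpha>: "bij_betw \<alpha> {1..CARD('k)} UNIV" and k: "k \<in> {1..CARD('k)}"
  shows "outcome_law D (max_strategy D \<alpha>) $ \<alpha> k = (real k ^ D - (real k - 1) ^ D) / real CARD('k) ^ D"
proof -
  let ?\<sigma> = "\<lambda>x. outcome_law D (max_strategy D \<alpha>) $ x"
  have "inj_on \<alpha> {1..m}" if "m \<le> CARD('k)" for m
    using \<alpha> that by (auto simp: bij_betw_def intro: inj_on_subset)
  then have sum: "(\<Sum>i\<in>{1..m}. ?\<sigma> (\<alpha> i)) = real m ^ D / real CARD('k) ^ D" if "m \<le> CARD('k)" for m
    using downset_mass_max_strategy[OF D \<alpha> that] that by (simp add: sum.reindex)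
  \<comment> \<open>The point mass at \<open>\<alpha> k\<close> is the difference of the masses of
    two consecutive initial segments; for \<open>k = 1\<close> the smaller one is empty.\<close>
  obtain m where m: "k = Suc m"
    using k by (cases k) auto
  show ?thesis
    using sum[of k] sum[of m] k by (simp add: m diff_divide_distrib)
qed

text \<open>Every kernel must put mass at least \<open>(m / K) ^ D\<close> on the \<open>m\<close> lowest labels, namely that of
  the label vectors with no other label; the maximum kernel attains all these bounds at once.\<close>

lemma kernel_law_max_strategy_unique:
  fixes L :: "'k::finite list \<Rightarrow> 'k \<Rightarrow> real"
  assumes D: "D \<ge> 1" and \<alpha>: "bij_betw \<alpha> {1..CARD('k)} UNIV"
    and L: "label_kernel D L" and law: "kernel_law D L = outcome_law D (max_strategy D \<alpha>)"
    and u: "u \<in> label_vectors D" and a: "a \<in> set u"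
    and max: "\<And>y. y \<in> set u \<Longrightarrow> inv_into {1..CARD('k)} \<alpha> y \<le> inv_into {1..CARD('k)} \<alpha> a"
  shows "L u a = 1"
proof -
  let ?r = "inv_into {1..CARD('k)} \<alpha>"
  \<comment> \<open>The number of labels strictly below \<open>a\<close>, which form
    \<open>?A\<close>. Ranks start at 1, so the subtraction is exact.\<close>
  define m where "m = ?r a - 1"
  have m: "m < ?r a" "m \<le> CARD('k)" "?r a = Suc m"
    using rank_UNIV(2)[OF \<alpha>, of a] by (auto simp: m_def)
  let ?A = "\<alpha> ` {1..m}" and ?V = "label_vectors D :: 'k list set"
  have rA: "?r x \<le> m" if "x \<in> ?A" for x
    using that m(2) bij_betw_inv_into_left[OF \<alpha>] by auto
  have cardA: "card ?A = m"
    using \<alpha> m(2) by (subst card_image) (auto simp: bij_betw_def intro: inj_on_subset)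
  have inner: "(\<Sum>x\<in>?A. L v x) = 1" if "v \<in> ?V" "set v \<subseteq> ?A" for v
    using label_kernelD(2,3)[OF L that(1)] that(2) sum.mono_neutral_right[of UNIV ?A "L v"] by auto
  have "real (m ^ D) = (\<Sum>v\<in>?V. \<Sum>x\<in>?A. L v x)"
    using downset_mass_max_strategy[OF D \<alpha> m(2)] unfolding law[symmetric] kernel_law_sum by simp
  moreover have "real (m ^ D) = (\<Sum>v\<in>?V. of_bool (set v \<subseteq> ?A))"
    using card_label_vectors_subset[of D ?A] cardA by (simp add: of_bool_def sum.If_cases Int_def)
  \<comment> \<open>Equality in the summed bound forces equality at every vector, in particular at
    \<open>u\<close>.\<close>
  ultimately have "(\<Sum>v\<in>?V. (\<Sum>x\<in>?A. L v x) - of_bool (set v \<subseteq> ?A)) = 0"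
    by (simp add: sum_subtractf)
  moreover have "\<forall>v\<in>?V. 0 \<le> (\<Sum>x\<in>?A. L v x) - of_bool (set v \<subseteq> ?A)"
    using inner label_kernelD(1)[OF L] by (auto simp: of_bool_def intro!: sum_nonneg)
  ultimately have "(\<Sum>x\<in>?A. L u x) - of_bool (set u \<subseteq> ?A) = 0"
    using u by (subst (asm) sum_nonneg_eq_0_iff) auto
  \<comment> \<open>Since \<open>a\<close> is outside \<open>?A\<close>, the kernel at
    \<open>u\<close> gives \<open>?A\<close> no mass. All other labels of \<open>u\<close> lie in
    \<open>?A\<close>, so only \<open>a\<close> remains.\<close>
  moreover have "\<not> set u \<subseteq> ?A"
    using a rA[of a] m(1) by (meson leD subsetD)
  ultimately have "(\<Sum>x\<in>?A. L u x) = 0"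
    by simp
  then have "\<forall>x\<in>?A. L u x = 0"
    using label_kernelD(1)[OF L u] by (subst (asm) sum_nonneg_eq_0_iff) auto
  moreover have "x \<in> ?A" if "x \<in> set u" "x \<noteq> a" for x
  proof -
    have "?r x \<noteq> ?r a"
      using that inj_eq[OF rank_UNIV(1)[OF \<alpha>]] by simp
    then have "?r x \<in> {1..m}"
      using max[OF that(1)] m(3) rank_UNIV(2)[OF \<alpha>, of x] by auto
    then show ?thesis
      using rank_UNIV(3)[OF \<alpha>, of x] by (metis imageI)
  qed
  ultimately have "L u x = 0" if "x \<noteq> a" for x
    using that label_kernelD(2)[OF L u] by blast
  then show ?thesis
    using sum.mono_neutral_right[of UNIV "{a}" "L u"] label_kernelD(3)[OF L u] by auto
qed

lemma max_strategy_imp_zero_one_kernels: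
  fixes \<alpha> :: "nat \<Rightarrow> 'k::finite"
  assumes D: "D \<ge> 1" and \<alpha>: "bij_betw \<alpha> {1..CARD('k)} UNIV"
  shows "zero_one_kernels D (outcome_law D (max_strategy D \<alpha>))"
  unfolding zero_one_kernels_def
proof (intro allI impI ballI; elim conjE)
  fix L and u :: "'k list"
  assume L: "label_kernel D L" "kernel_law D L = outcome_law D (max_strategy D \<alpha>)" and u: "u \<in> label_vectors D"
  then have "u \<noteq> []"
    using D by (auto simp: label_vectors_def)
  then obtain a where "a \<in> set u" "\<And>y. y \<in> set u \<Longrightarrow> inv_into {1..CARD('k)} \<alpha> y \<le> inv_into {1..CARD('k)} \<alpha> a"
    using maximal_label by blast
  then show "\<exists>x. L u x = 1"
    using kernel_law_max_strategy_unique[OF D \<alpha> L u] by blast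
qed

text \<open>Two labels are compared through a label vector containing exactly these two; this is where
  \<open>D \<ge> 2\<close> enters.\<close>

lemma extreme_imp_max_strategy:
  fixes L :: "'k::finite list \<Rightarrow> 'k \<Rightarrow> real"
  assumes D: "D \<ge> 2" and L: "label_kernel D L"
    and ext: "kernel_law D L extreme_point_of {kernel_law D L | L. label_kernel D L}"
  obtains \<alpha> where "bij_betw \<alpha> {1..CARD('k)} (UNIV :: 'k set)"
    "kernel_law D L = outcome_law D (max_strategy D \<alpha>)"
proof -
  have "\<forall>u\<in>label_vectors D. \<exists>x. L u x = 1"
    using extreme_imp_zero_one[OF L ext] by blast
  then obtain f where f1: "\<And>u. u \<in> label_vectors D \<Longrightarrow> L u (f u) = 1"
    by metis
  have f: "f u \<in> set u" if "u \<in> label_vectors D" for u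
    using f1[OF that] label_kernelD(2)[OF L that, of "f u"] by force
  have law: "kernel_law D L = choice_law D f"
    unfolding choice_law_def by (rule kernel_law_cong) (rule label_kernel_eq_of_bool[OF L _ f1])
  note acyclic = extreme_choice_acyclic[OF ext[unfolded law] f]
  \<comment> \<open>Revealed preference: \<open>x\<close> is above \<open>y\<close> if it is chosen
    from some vector containing \<open>y\<close>.\<close>
  define le where "le y x \<longleftrightarrow> x = y \<or> (\<exists>u\<in>label_vectors D. f u = x \<and> y \<in> set u)" for x y
  have refl: "le x x" for x
    by (simp add: le_def)
  have total: "le x y \<or> le y x" for x y
  proof -
    let ?u = "x # replicate (D - 1) y"
    have u: "?u \<in> label_vectors D" and set: "set ?u = {x, y}"
      using D by (auto simp: label_vectors_def)
    show ?thesis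
      using f[OF u] u set unfolding le_def by blast
  qed
  have antisym: "x = y" if "le x y" "le y x" for x y
    using that acyclic(1) unfolding le_def by blast
  \<comment> \<open>Otherwise totality gives \<open>le z x\<close>, closing a preference cycle of
    length 3.\<close>
  have trans: "le x z" if "le x y" "le y z" for x y z
    using that total[of x z] acyclic(2) antisym unfolding le_def by metis
  \<comment> \<open>The label itself is counted, so ranks run from 1 to
    \<open>CARD('k)\<close>.\<close>
  define r where "r x = card {y. le y x}" for x
  have mono: "r x \<le> r y" if "le x y" for x y
    unfolding r_def using that trans by (intro card_mono) auto
  have strict: "r x < r y" if "le x y" "x \<noteq> y" for x y
  proof -
    have "{z. le z x} \<subseteq> {z. le z y}" "y \<in> {z. le z y}" "y \<notin> {z. le z x}"
      using that trans antisym refl by blast+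
    then show ?thesis
      unfolding r_def by (intro psubset_card_mono) auto
  qed
  have "inj r"
    using strict total by (metis injI less_irrefl)
  moreover have "range r \<subseteq> {1..CARD('k)}"
    using refl card_mono[of "UNIV :: 'k set"] by (fastforce simp: r_def Suc_le_eq card_gt_0_iff)
  ultimately have r: "bij_betw r UNIV {1..CARD('k)}"
    unfolding bij_betw_def by (simp add: card_image card_subset_eq)
  \<comment> \<open>With this choice the rank function belonging to \<open>\<alpha>\<close> is
    \<open>r\<close> again.\<close>
  define \<alpha> where "\<alpha> = inv_into UNIV r"
  have \<alpha>: "bij_betw \<alpha> {1..CARD('k)} UNIV"
    unfolding \<alpha>_def by (rule bij_betw_inv_into[OF r])
  have inv: "inv_into {1..CARD('k)} \<alpha> x = r x" for x
    unfolding \<alpha>_def by (rule inv_into_inv_into_eq[OF r]) simp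
  have "label_prob D (max_strategy D \<alpha>) u x = of_bool (x = f u)" if u: "u \<in> label_vectors D" for u x
  proof (rule label_prob_max_strategy[OF \<alpha> u f[OF u]])
    fix y assume "y \<in> set u"
    then show "inv_into {1..CARD('k)} \<alpha> y \<le> inv_into {1..CARD('k)} \<alpha> (f u)"
      unfolding inv using u by (intro mono) (auto simp: le_def)
  qed
  then have "kernel_law D L = outcome_law D (max_strategy D \<alpha>)"
    unfolding law choice_law_def outcome_law_eq_kernel_law by (intro kernel_law_cong) simp
  with \<alpha> that show ?thesis
    by blast
qed

text \<open>The law of a maximum strategy lists the prescribed values along the order. Conversely,
  matching the values with the labels that carry them recovers such an order.\<close>

lemma max_strategy_iff_value_distribution:
  fixes \<sigma> :: "real ^ 'k::finite"
  assumes D: "D \<ge> 1"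
  shows "(\<exists>\<alpha>. bij_betw \<alpha> {1..CARD('k)} (UNIV :: 'k set) \<and> \<sigma> = outcome_law D (max_strategy D \<alpha>)) \<longleftrightarrow>
    image_mset (\<lambda>x. \<sigma> $ x) (mset_set UNIV) =
    image_mset (\<lambda>k. (real k ^ D - (real k - 1) ^ D) / real CARD('k) ^ D) (mset_set {1..CARD('k)})"
    (is "?l \<longleftrightarrow> _ = image_mset ?g _")
proof -
  have reindex: "image_mset (\<lambda>x. \<sigma> $ x) (mset_set UNIV) = image_mset (\<lambda>k. \<sigma> $ \<alpha> k) (mset_set {1..CARD('k)})"
    if "bij_betw \<alpha> {1..CARD('k)} (UNIV :: 'k set)" for \<alpha>
  proof -
    have "mset_set UNIV = image_mset \<alpha> (mset_set {1..CARD('k)})"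
      using that by (simp add: bij_betw_def image_mset_mset_set)
    then show ?thesis
      by (simp only: multiset.map_comp comp_def)
  qed
  show ?thesis
  proof
    assume ?l
    then show "image_mset (\<lambda>x. \<sigma> $ x) (mset_set UNIV) = image_mset ?g (mset_set {1..CARD('k)})"
      using outcome_law_max_strategy[OF D] reindex by (force intro!: image_mset_cong)
  next
    assume eq: "image_mset (\<lambda>x. \<sigma> $ x) (mset_set UNIV) = image_mset ?g (mset_set {1..CARD('k)})"
    \<comment> \<open>An arbitrary enumeration of the labels; \<open>\<pi>\<close> then rearranges
      it so that the values appear in the prescribed sequence.\<close>
    obtain \<beta> where \<beta>: "bij_betw \<beta> {1..CARD('k)} (UNIV :: 'k set)"
      using ex_bij_betw_nat_finite_1[of "UNIV :: 'k set"] by auto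
    from eq have "image_mset ?g (mset_set {1..CARD('k)}) = image_mset (\<lambda>k. \<sigma> $ \<beta> k) (mset_set {1..CARD('k)})"
      by (simp add: reindex[OF \<beta>])
    then obtain \<pi> where \<pi>: "\<pi> permutes {1..CARD('k)}" and val: "\<And>k. k \<in> {1..CARD('k)} \<Longrightarrow> ?g k = \<sigma> $ \<beta> (\<pi> k)"
      by (rule image_mset_eq_implies_permutes[rotated]) auto
    have \<alpha>: "bij_betw (\<beta> \<circ> \<pi>) {1..CARD('k)} UNIV"
      by (rule bij_betw_trans[OF permutes_imp_bij[OF \<pi>] \<beta>])
    have "\<sigma> $ x = outcome_law D (max_strategy D (\<beta> \<circ> \<pi>)) $ x" for x
    proof -
      obtain k where k: "k \<in> {1..CARD('k)}" "x = (\<beta> \<circ> \<pi>) k"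
        using \<alpha> unfolding bij_betw_def by (metis UNIV_I imageE)
      show ?thesis
        unfolding k(2) outcome_law_max_strategy[OF D \<alpha> k(1)] by (simp add: val[OF k(1)])
    qed
    with \<alpha> show ?l
      by (auto simp: vec_eq_iff)
  qed
qed

theorem theoremB:
  fixes D :: nat and p :: "'k::finite strategy"
  assumes "D \<ge> 2" and "single_edge_strategy D p"
  shows "let
      i = outcome_law D p extreme_point_of {outcome_law D q | q. single_edge_strategy D q};
      ii = (\<forall>q. single_edge_strategy D q \<and> consistent D q \<and> outcome_law D q = outcome_law D p
              \<longrightarrow> deterministic D q);
      iii = (\<exists>\<alpha>. bij_betw \<alpha> {1..CARD('k)} (UNIV :: 'k set) \<and>
              outcome_law D p = outcome_law D (max_strategy D \<alpha>));
      iv = (image_mset (\<lambda>x. outcome_law D p $ x) (mset_set UNIV) =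
            image_mset (\<lambda>k. (real k ^ D - (real k - 1) ^ D) / real CARD('k) ^ D)
              (mset_set {1..CARD('k)}))
    in (i \<longleftrightarrow> ii) \<and> (i \<longleftrightarrow> iii) \<and> (i \<longleftrightarrow> iv)"
proof -
  have D: "D \<ge> 1"
    using assms(1) by simp
  have L: "label_kernel D (label_prob D p)"
    by (rule label_kernel_label_prob) fact
  note law = outcome_law_eq_kernel_law[of D p]
  \<comment> \<open>The implications run in the cycle (ii), (i), (iii), (ii); condition (iv) joins
    through its equivalence with (iii).\<close>
  have "zero_one_kernels D (outcome_law D p) \<Longrightarrow>
      outcome_law D p extreme_point_of {kernel_law D L | L. label_kernel D L}"
    unfolding law by (rule zero_one_kernels_imp_extreme[OF L])
  moreover have "outcome_law D p extreme_point_of {kernel_law D L | L. label_kernel D L} \<Longrightarrow>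
      \<exists>\<alpha>. bij_betw \<alpha> {1..CARD('k)} (UNIV :: 'k set) \<and> outcome_law D p = outcome_law D (max_strategy D \<alpha>)"
    using extreme_imp_max_strategy[OF assms(1) L] unfolding law by metis
  moreover have "\<exists>\<alpha>. bij_betw \<alpha> {1..CARD('k)} (UNIV :: 'k set) \<and> outcome_law D p = outcome_law D (max_strategy D \<alpha>) \<Longrightarrow>
      zero_one_kernels D (outcome_law D p)"
    using max_strategy_imp_zero_one_kernels[OF D] by metis
  ultimately show ?thesis
    unfolding Let_def outcome_laws_eq_kernel_laws
      zero_one_kernels_iff_deterministic[of D "outcome_law D p", symmetric]
      max_strategy_iff_value_distribution[OF D, symmetric]
    by blast
qed

end
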